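(* Let $a, b \in \mathbb{R}$ be such that $b \geq 2$, and let $\Phi(a,b,\cdot)$ be the Kummer confluent hypergeometric function with parameters $a, b$. (a) If $b = 2a$, then all nontrivial roots $z$ of $\Phi(a,b,\cdot)$ are purely imaginary. (b) If $b > 2a$, then all nontrivial roots $z$ of $\Phi(a,b,\cdot)$ satisfy $\Re(z) > 0$. (c) If $b < 2a$, then all nontrivial roots $z$ of $\Phi(a,b,\cdot)$ satisfy $\Re(z) < 0$. (d) If $b \neq 2a$, then all nontrivial roots $z$ of $\Phi(a,b,\cdot)$ satisfy $$(b - 2a)^2\, \Im(z)^2 - \left(4a(b - a) - 2b\right) \Re(z)^2 > 0.$$
   Context: For $a, b \in \mathbb{C}$ with $b$ not a nonpositive integer, the Kummer confluent hypergeometric function $\Phi(a,b,\cdot): \mathbb{C} \to \mathbb{C}$ is the entire function $$\Phi(a,b,z) = \sum_{j=0}^{\infty} \frac{(a)_j}{(b)_j} \frac{z^j}{j!},$$ where $(\alpha)_0 = 1$ and $(\alpha)_{j+1} = (\alpha + j)(\alpha)_j$ for $j \in \mathbb{N}$ (Pochhammer symbol, ascending factorial). A nontrivial root is a root $z \neq 0$ (since $\Phi(a,b,0) = 1$, every root of $\Phi(a,b,\cdot)$ is nontrivial). $\Re$ and $\Im$ denote real and imaginary parts. *)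

theory Defs
  imports "HOL-Analysis.Analysis"
begin

text \<open>
  The Kummer confluent hypergeometric function. It is meant for parameters \<open>b\<close> that are not
  nonpositive integers; otherwise \<open>pochhammer b j\<close> vanishes for all large \<open>j\<close> and those terms are
  \<open>0\<close> by the convention on division by zero.
\<close>
definition kummer :: "complex \<Rightarrow> complex \<Rightarrow> complex \<Rightarrow> complex" where
  "kummer a b z = (\<Sum>j. pochhammer a j / pochhammer b j * (z ^ j / fact j))"

lemma summable_kummer:
  fixes a b z :: complex
  assumes b: "b \<notin> \<int>\<^sub>\<le>\<^sub>0"
  shows "summable (\<lambda>j. pochhammer a j / pochhammer b j * (z ^ j / fact j))"
proof (cases "a \<in> \<int>\<^sub>\<le>\<^sub>0 \<or> z = 0")
  case True
  then obtain N where N: "\<And>j. j \<ge> N \<Longrightarrow> pochhammer a j = 0 \<or> z ^ j = 0"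
  proof
    assume "a \<in> \<int>\<^sub>\<le>\<^sub>0"
    then obtain n where "a = - of_nat n"
      by (elim nonpos_Ints_cases')
    then have "pochhammer a j = 0" if "j \<ge> Suc n" for j
      using that by (auto simp: pochhammer_eq_0_iff)
    then show thesis using that by blast
  next
    assume "z = 0"
    then have "z ^ j = 0" if "j \<ge> 1" for j
      using that by simp
    then show thesis using that by blast
  qed
  show ?thesis
  proof (rule summable_finite[of "{..<N}"])
    show "pochhammer a j / pochhammer b j * (z ^ j / fact j) = 0" if "j \<notin> {..<N}" for j
      using N[of j] that by (simp only: lessThan_iff not_less) auto
  qed simp
next
  case False
  let ?f = "\<lambda>j. pochhammer a j / pochhammer b j * (z ^ j / fact j)"
  have ratio: "?f (Suc j) = ((a + of_nat j) / (b + of_nat j) * (z / of_nat (Suc j))) * ?f j" for j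
    by (simp add: pochhammer_rec' ac_simps)
  have 1: "(\<lambda>j. c / of_nat (Suc j)) \<longlonglongrightarrow> 0" for c :: complex
    using LIMSEQ_Suc[OF lim_const_over_n[of c]] by simp
  have "(\<lambda>j. 1 + (c - 1) / of_nat (Suc j)) \<longlonglongrightarrow> 1 + 0" for c :: complex
    by (intro tendsto_intros 1)
  moreover have "1 + (c - 1) / of_nat (Suc j) = (c + of_nat j) / of_nat (Suc j)"
    for c :: complex and j
    proof -
    have "1 + (c - 1) / of_nat (Suc j) = (of_nat (Suc j) + (c - 1)) / of_nat (Suc j)"
      using of_nat_neq_0[of j, where 'a = complex] by (simp add: add_divide_distrib del: of_nat_Suc)
    also have "of_nat (Suc j) + (c - 1) = c + of_nat j"
      by simp
    finally show ?thesis .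
  qed
  ultimately have 2: "(\<lambda>j. (c + of_nat j) / of_nat (Suc j)) \<longlonglongrightarrow> 1" for c :: complex
    by simp
  have "(\<lambda>j. ((a + of_nat j) / of_nat (Suc j)) / ((b + of_nat j) / of_nat (Suc j))
            * (z / of_nat (Suc j))) \<longlonglongrightarrow> 1 / 1 * 0"
    by (intro tendsto_mult tendsto_divide 1 2) simp
  moreover have "((a + of_nat j) / of_nat (Suc j)) / ((b + of_nat j) / of_nat (Suc j))
                   = (a + of_nat j) / (b + of_nat j)" for j
    using of_nat_neq_0[of j, where 'a = complex] 
    by (metis divide_divide_times_eq mult.commute mult_divide_mult_cancel_left)
  ultimately have "(\<lambda>j. (a + of_nat j) / (b + of_nat j) * (z / of_nat (Suc j))) \<longlonglongrightarrow> 0"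
    by (simp only: mult_zero_right)
  then have "eventually (\<lambda>j. norm ((a + of_nat j) / (b + of_nat j) * (z / of_nat (Suc j))) < 1/2)
               sequentially"
    by (intro order_tendstoD(2)[OF tendsto_norm_zero]) auto
  then obtain N where N:
    "\<And>j. j \<ge> N \<Longrightarrow> norm ((a + of_nat j) / (b + of_nat j) * (z / of_nat (Suc j))) < 1/2"
    by (auto simp: eventually_sequentially)
  show ?thesis
  proof (rule summable_ratio_test)
    show "(1/2::real) < 1" by simp
    show "norm (?f (Suc n)) \<le> 1/2 * norm (?f n)" if "n \<ge> N" for n
      unfolding ratio norm_mult[of _ "?f n"]
      using N[OF that] by (intro mult_right_mono) auto
  qed
qed

lemma kummer_0 [simp]: "kummer a b 0 = 1"
proof -
  have "(\<lambda>j. pochhammer a j / pochhammer b j * (0 ^ j / fact j)) sums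
          (\<Sum>j\<in>{0}. pochhammer a j / pochhammer b j * (0 ^ j / fact j))"
    by (rule sums_finite) auto
  then show ?thesis
    unfolding kummer_def by (auto dest: sums_unique)
qed

end

theory Submission
  imports Defs
begin

text \<open>Kummer's equation is restricted to the segment from 0 to a root z. For Phi =
  \<open>kummer a b\<close>, put f(t) = t^(b/2) exp(-t z/2) Phi(t z). Then f'' = q f with q(t) =
  z^2/4 - k z/t + b(b-2)/(4 t^2), where k = b/2 - a, and f vanishes at t = 0 and at t = 1. Since
  (cnj f * f')' = |f'|^2 + q |f|^2, integration over [0, 1] shows that for every real l the integral
  of |f'|^2 + (Re q + l Im q) |f|^2 is zero. Hence no l can make Re q + l Im q nonnegative on (0,
  1), as f would then be constant and thus zero, against Phi(0) = 1. This obstruction is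
  \<open>kummer_root_potential\<close>, carried out by monotonicity instead of integration. If a
  root violated one of the claims, a suitable l would exist: \<open>kummer_root_sign\<close> finds
  it for (a)-(c), and \<open>kummer_root_sector\<close> finds it for (d).\<close>

section \<open>Kummer's differential equation\<close>

lemma kummer_has_derivatives:
  fixes a b :: complex
  assumes b: "b \<notin> \<int>\<^sub>\<le>\<^sub>0"
  obtains D1 D2 where
    "\<And>w. (kummer a b has_field_derivative D1 w) (at w)"
    "\<And>w. (D1 has_field_derivative D2 w) (at w)"
    "\<And>w. w * D2 w + (b - w) * D1 w = a * kummer a b w"
proof -
  define c where "c = (\<lambda>n. pochhammer a n / (pochhammer b n * fact n))"
  have kummer: "kummer a b = (\<lambda>w. \<Sum>n. c n * w ^ n)"
    by (auto simp: kummer_def c_def fun_eq_iff)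
  have S0: "summable (\<lambda>n. c n * w ^ n)" for w
    using summable_kummer[OF b, of a w] by (simp add: c_def)
  have S1: "summable (\<lambda>n. diffs c n * w ^ n)" for w
    by (rule termdiff_converges_all) (rule S0)
  have S2: "summable (\<lambda>n. diffs (diffs c) n * w ^ n)" for w
    by (rule termdiff_converges_all) (rule S1)
  \<comment> \<open>Kummer's equation on the level of coefficients: this is the ratio (a + n) / (b +
    n) of consecutive Pochhammer quotients, whose denominator is nonzero by the assumption on
    \<open>b\<close>.\<close>
  have rec: "of_nat n * diffs c n + b * diffs c n = of_nat n * c n + a * c n" for n
  proof -
    have "b + of_nat n \<noteq> 0"
      using b by (metis add.inverse_unique minus_of_nat_in_nonpos_Ints add.commute)
    moreover have "diffs c n = (a + of_nat n) / (b + of_nat n) * c n"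
      using of_nat_neq_0[of n, where 'a = complex]
      by (simp add: diffs_def c_def pochhammer_rec' mult_ac del: of_nat_Suc)
    ultimately have "(b + of_nat n) * diffs c n = (a + of_nat n) * c n"
      by simp
    then show ?thesis
      by (simp add: algebra_simps)
  qed
  show thesis
  proof
    show "(kummer a b has_field_derivative (\<Sum>n. diffs c n * w ^ n)) (at w)" for w
      unfolding kummer by (rule termdiffs_strong_converges_everywhere) (rule S0)
    show "((\<lambda>w. \<Sum>n. diffs c n * w ^ n) has_field_derivative (\<Sum>n. diffs (diffs c) n * w ^ n)) (at w)" for w
      by (rule termdiffs_strong_converges_everywhere) (rule S1)
    show "w * (\<Sum>n. diffs (diffs c) n * w ^ n) + (b - w) * (\<Sum>n. diffs c n * w ^ n)
            = a * kummer a b w" for w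
    proof -
      \<comment> \<open>Multiplying a derived series by \<open>w\<close> restores the exponents; the
        term for n = 0 is zero, so the index can be shifted.\<close>
      have shift: "(\<lambda>n. of_nat n * d n * w ^ n) sums (w * (\<Sum>n. diffs d n * w ^ n))"
        if "summable (\<lambda>n. diffs d n * w ^ n)" for d :: "nat \<Rightarrow> complex"
      proof -
        have "(\<lambda>n. w * (diffs d n * w ^ n)) sums (w * (\<Sum>n. diffs d n * w ^ n))"
          by (intro sums_mult summable_sums that)
        also have "(\<lambda>n. w * (diffs d n * w ^ n)) = (\<lambda>n. of_nat (Suc n) * d (Suc n) * w ^ Suc n)"
          by (simp add: diffs_def fun_eq_iff mult_ac)
        finally show ?thesis
          by (subst (asm) sums_Suc_iff) simp
      qed
      have "(\<lambda>n. of_nat n * diffs c n * w ^ n + b * (diffs c n * w ^ n)) sums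
             (w * (\<Sum>n. diffs (diffs c) n * w ^ n) + b * (\<Sum>n. diffs c n * w ^ n))"
        by (intro sums_add shift S2 sums_mult summable_sums S1)
      moreover have "(\<lambda>n. of_nat n * c n * w ^ n + a * (c n * w ^ n)) sums
             (w * (\<Sum>n. diffs c n * w ^ n) + a * (\<Sum>n. c n * w ^ n))"
        by (intro sums_add shift S1 sums_mult summable_sums S0)
      moreover have "of_nat n * diffs c n * w ^ n + b * (diffs c n * w ^ n)
             = of_nat n * c n * w ^ n + a * (c n * w ^ n)" for n
        using arg_cong[OF rec[of n], of "\<lambda>x. x * w ^ n"] by (simp add: algebra_simps)
      ultimately have "w * (\<Sum>n. diffs (diffs c) n * w ^ n) + b * (\<Sum>n. diffs c n * w ^ n)
             = w * (\<Sum>n. diffs c n * w ^ n) + a * (\<Sum>n. c n * w ^ n)"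
        using sums_unique2 by simp
      then show ?thesis
        by (simp add: kummer algebra_simps)
    qed
  qed
qed

text \<open>The substitution that removes the first-order term \<open>- w \<Phi>'\<close> of Kummer's equation.\<close>
lemma kummer_exp_has_derivatives:
  fixes a b :: complex
  assumes b: "b \<notin> \<int>\<^sub>\<le>\<^sub>0"
  defines "G \<equiv> \<lambda>w. exp (- w / 2) * kummer a b w"
  obtains D1 D2 where
    "\<And>w. (G has_field_derivative D1 w) (at w)"
    "\<And>w. (D1 has_field_derivative D2 w) (at w)"
    "\<And>w. w * D2 w + b * D1 w = (w / 4 - (b / 2 - a)) * G w"
proof -
  obtain K1 K2 where K: 
    "\<And>w. (kummer a b has_field_derivative K1 w) (at w)"
    "\<And>w. (K1 has_field_derivative K2 w) (at w)"
    "\<And>w. w * K2 w + (b - w) * K1 w = a * kummer a b w"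
    using kummer_has_derivatives[OF b, of a] by metis
  show thesis
  proof
    show "(G has_field_derivative exp (- w / 2) * (K1 w - kummer a b w / 2)) (at w)" for w
      unfolding G_def by (auto intro!: derivative_eq_intros K(1) simp: algebra_simps)
    show "((\<lambda>w. exp (- w / 2) * (K1 w - kummer a b w / 2)) has_field_derivative
            exp (- w / 2) * (K2 w - K1 w + kummer a b w / 4)) (at w)" for w
      by (auto intro!: derivative_eq_intros K(1,2) simp: field_simps)
    show "w * (exp (- w / 2) * (K2 w - K1 w + kummer a b w / 4))
           + b * (exp (- w / 2) * (K1 w - kummer a b w / 2))
           = (w / 4 - (b / 2 - a)) * G w" for w
    proof -
      have "w * (K2 w - K1 w + kummer a b w / 4) + b * (K1 w - kummer a b w / 2)
              = (w / 4 - (b / 2 - a)) * kummer a b w"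
        using K(3)[of w] by (simp add: algebra_simps)
      from arg_cong[OF this, of "\<lambda>x. exp (- w / 2) * x"] show ?thesis
        by (simp add: G_def algebra_simps)
    qed
  qed
qed

section \<open>The energy argument on the segment from 0 to a root\<close>

text \<open>With \<open>f t = t powr (b/2) * g t\<close> the equation becomes \<open>f'' = q f\<close> for the \<open>q\<close> of the assumption.
  The function \<open>Re ((1 - \<i> l) * cnj f * f')\<close> vanishes at \<open>0\<close> and at \<open>1\<close>, and its derivative
  is \<open>\<bar>f'\<bar>\<^sup>2 + (Re q + l * Im q) \<bar>f\<bar>\<^sup>2\<close>.\<close>
lemma kummer_root_potential:
  fixes a b l :: real and z :: complex
  assumes b: "b \<ge> 2"
    and root: "kummer (of_real a) (of_real b) z = 0"
    and pos: "\<And>t. 0 < t \<Longrightarrow> t < 1 \<Longrightarrow>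
      0 \<le> ((Re z)\<^sup>2 - (Im z)\<^sup>2) / 4 - (b / 2 - a) * Re z / t + b * (b - 2) / (4 * t\<^sup>2)
          + l * Im z * (Re z / 2 - (b / 2 - a) / t)"
  shows False
proof -
  have b0: "complex_of_real b \<notin> \<int>\<^sub>\<le>\<^sub>0"
  proof
    assume "complex_of_real b \<in> \<int>\<^sub>\<le>\<^sub>0"
    then obtain n where "complex_of_real b = - of_nat n"
      by (elim nonpos_Ints_cases')
    from arg_cong[OF this, of Re] show False
      using b by simp
  qed
  obtain D1 D2 where D:
    "\<And>w. ((\<lambda>w. exp (- w / 2) * kummer (of_real a) (of_real b) w) has_field_derivative D1 w) (at w)"
    "\<And>w. (D1 has_field_derivative D2 w) (at w)"
    "\<And>w. w * D2 w + of_real b * D1 w = (w / 4 - (of_real b / 2 - of_real a)) *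
            (exp (- w / 2) * kummer (of_real a) (of_real b) w)"
    using kummer_exp_has_derivatives[OF b0, of "of_real a"] by blast
  define g where "g = (\<lambda>t::real. exp (- (of_real t * z) / 2) * kummer (of_real a) (of_real b) (of_real t * z))"
  define g1 where "g1 = (\<lambda>t::real. z * D1 (of_real t * z))"
  define g2 where "g2 = (\<lambda>t::real. z\<^sup>2 * D2 (of_real t * z))"
  have dg: "(g has_vector_derivative g1 t) (at t)" for t
  proof -
    have "((\<lambda>t. complex_of_real t * z) has_vector_derivative z) (at t)"
      by (auto intro!: derivative_eq_intros)
    from field_vector_diff_chain_at[OF this D(1)] show ?thesis
      by (simp add: g_def g1_def o_def mult.commute)
  qed
  have dg1: "(g1 has_vector_derivative g2 t) (at t)" for t
  proof -
    have "((\<lambda>t. complex_of_real t * z) has_vector_derivative z) (at t)"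
      by (auto intro!: derivative_eq_intros)
    from field_vector_diff_chain_at[OF this D(2)] 
    have "((\<lambda>t. D1 (of_real t * z)) has_vector_derivative D2 (of_real t * z) * z) (at t)"
      by (simp add: o_def mult.commute)
    from has_vector_derivative_mult_right[OF this, of z] show ?thesis
      by (simp add: g1_def g2_def power2_eq_square mult_ac)
  qed
  \<comment> \<open>The equation at the point \<open>t * z\<close>, multiplied by \<open>z\<close>
    because each derivative in \<open>t\<close> contributes a factor \<open>z\<close>.\<close>
  have ode: "of_real t * g2 t + b * g1 t = (z\<^sup>2 * t / 4 - (b / 2 - a) * z) * g t" for t
    using arg_cong[OF D(3)[of "t * z"], of "\<lambda>x. z * x"]
    by (simp add: g_def g1_def g2_def algebra_simps power2_eq_square)
  have g0: "g 0 = 1" and g1: "g 1 = 0"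
    using root by (simp_all add: g_def)
  \<comment> \<open>\<open>W\<close> is \<open>cnj f * f'\<close> expanded in terms of
    \<open>g\<close>. Likewise f' = t^(b/2) * \<open>h\<close>, and \<open>Q\<close> is Re q + l Im
    q.\<close>
  define W where "W = (\<lambda>t. (t powr b) *\<^sub>R (cnj (g t) * g1 t) + (b / 2 * t powr (b - 1)) *\<^sub>R (cnj (g t) * g t))"
  define F where "F = (\<lambda>t. Re ((1 - \<i> * l) * W t))"
  define h where "h = (\<lambda>t. g1 t + (b / (2 * t)) *\<^sub>R g t)"
  define Q where "Q = (\<lambda>t. ((Re z)\<^sup>2 - (Im z)\<^sup>2) / 4 - (b / 2 - a) * Re z / t + b * (b - 2) / (4 * t\<^sup>2)
          + l * Im z * (Re z / 2 - (b / 2 - a) / t))"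
  have dF: "(F has_real_derivative t powr b * ((norm (h t))\<^sup>2 + Q t * (norm (g t))\<^sup>2)) (at t)"
    if t: "t > 0" for t
  proof -
    define q where "q = z\<^sup>2 / 4 - (b / 2 - a) * z / t + b * (b - 2) / (4 * t\<^sup>2)"
    have Q: "Q t = Re q + l * Im q"
      using t by (simp add: Q_def q_def power2_eq_square algebra_simps
        flip: of_real_mult of_real_power of_real_diff)
    have g2: "g2 t = ((z\<^sup>2 * t / 4 - (b / 2 - a) * z) * g t - b * g1 t) / t"
      using ode[of t] t by (simp add: field_simps)
    have P: "t powr (b - 1) = t powr b / t" "t powr (b - 1 - 1) = t powr b / t\<^sup>2"
      using t by (simp_all add: powr_diff power2_eq_square)
    have "(W has_vector_derivative
            ((t powr b) *\<^sub>R (cnj (g t) * g2 t + cnj (g1 t) * g1 t)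
               + (b * t powr (b - 1)) *\<^sub>R (cnj (g t) * g1 t))
          + ((b / 2 * t powr (b - 1)) *\<^sub>R (cnj (g t) * g1 t + cnj (g1 t) * g t)
               + (b / 2 * ((b - 1) * t powr (b - 1 - 1))) *\<^sub>R (cnj (g t) * g t))) (at t)"
      unfolding W_def using t
      by (intro has_vector_derivative_add has_vector_derivative_scaleR has_vector_derivative_mult
            has_vector_derivative_cnj dg dg1 DERIV_cmult has_real_derivative_powr)
    also have "((t powr b) *\<^sub>R (cnj (g t) * g2 t + cnj (g1 t) * g1 t)
               + (b * t powr (b - 1)) *\<^sub>R (cnj (g t) * g1 t))
          + ((b / 2 * t powr (b - 1)) *\<^sub>R (cnj (g t) * g1 t + cnj (g1 t) * g t)
               + (b / 2 * ((b - 1) * t powr (b - 1 - 1))) *\<^sub>R (cnj (g t) * g t))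
       = of_real (t powr b) * (of_real ((norm (h t))\<^sup>2) + q * of_real ((norm (g t))\<^sup>2))"
      using t unfolding P g2 q_def h_def complex_norm_square scaleR_conv_of_real
      by (simp add: field_simps power2_eq_square)
    finally have "(W has_vector_derivative of_real (t powr b) *
        (of_real ((norm (h t))\<^sup>2) + q * of_real ((norm (g t))\<^sup>2))) (at t)" .
    from has_vector_derivative_mult_right[OF this, of "1 - \<i> * l"]
    have "(F has_vector_derivative Re ((1 - \<i> * l) * (of_real (t powr b) *
        (of_real ((norm (h t))\<^sup>2) + q * of_real ((norm (g t))\<^sup>2))))) (at t)"
      unfolding F_def by (rule bounded_linear.has_vector_derivative[OF bounded_linear_Re])
    then show ?thesis
      unfolding Q has_real_derivative_iff_has_vector_derivative
      by (simp add: algebra_simps del: of_real_power)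
  qed
  have cont: "continuous_on S g" "continuous_on S g1" for S
    by (rule continuous_on_vector_derivative[OF has_vector_derivative_at_within[OF dg]],
        rule continuous_on_vector_derivative[OF has_vector_derivative_at_within[OF dg1]])
  \<comment> \<open>Continuity at 0 rests on the exponents b and b - 1 being positive, so that the
    value \<open>0 powr _\<close> = 0 is the limit there.\<close>
  have contF: "continuous_on {0..1} F"
    unfolding F_def W_def using b
    by (intro continuous_intros continuous_on_powr' cont) auto
  have F01: "F 0 = 0" "F 1 = 0"
    by (simp_all add: F_def W_def g1)
  have Q: "0 \<le> t powr b * ((norm (h t))\<^sup>2 + Q t * (norm (g t))\<^sup>2)" if "0 < t" "t < 1" for t
    using pos[OF that] by (auto simp: Q_def)
  have mono: "F s \<le> F t" if "0 \<le> s" "s \<le> t" "t \<le> 1" for s t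
  proof (rule DERIV_nonneg_imp_increasing_open[of s t F])
    show "\<exists>y. (F has_real_derivative y) (at r) \<and> 0 \<le> y" if "s < r" "r < t" for r
      using dF[of r] Q[of r] that \<open>0 \<le> s\<close> \<open>t \<le> 1\<close> by auto
    show "continuous_on {s..t} F"
      using that by (intro continuous_on_subset[OF contF]) auto
  qed (use that in auto)
  \<comment> \<open>A nondecreasing function with equal values at both ends is constant.\<close>
  have F0: "F t = 0" if "0 \<le> t" "t \<le> 1" for t
    using mono[of 0 t] mono[of t 1] that F01 by simp
  \<comment> \<open>The derivative of \<open>F\<close> is now zero, yet it is a positive factor
    times a sum of two nonnegative terms, so each term vanishes.\<close>
  have h0: "h t = 0" if t: "0 < t" "t < 1" for t
  proof -
    have "(F has_real_derivative 0) (at t)"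
      by (rule has_field_derivative_transform_within_open[of "\<lambda>_. 0" _ _ "{0<..<1}"])
        (use t F0 in auto)
    from DERIV_unique[OF this dF[OF t(1)]] show ?thesis
      using t pos[OF t] by (auto simp: Q_def add_nonneg_eq_0_iff)
  qed
  define f where "f = (\<lambda>t. (t powr (b / 2)) *\<^sub>R g t)"
  have df: "(f has_vector_derivative 0) (at t)" if t: "0 < t" "t < 1" for t
  proof -
    have "(f has_vector_derivative (t powr (b / 2)) *\<^sub>R g1 t + (b / 2 * t powr (b / 2 - 1)) *\<^sub>R g t) (at t)"
      unfolding f_def using t
      by (intro has_vector_derivative_scaleR dg has_real_derivative_powr)
    also have "(t powr (b / 2)) *\<^sub>R g1 t + (b / 2 * t powr (b / 2 - 1)) *\<^sub>R g t = (t powr (b / 2)) *\<^sub>R h t"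
      using t by (simp add: h_def powr_diff scaleR_right_distrib)
    finally show ?thesis
      using h0[OF t] by simp
  qed
  have "continuous_on {0..1} f"
    unfolding f_def using b
    by (intro continuous_intros continuous_on_powr' cont) auto
  then have f0: "f t = 0" if "t \<in> {0..1}" for t
  proof (rule has_derivative_zero_unique_strong_interval[of "{0, 1}" 0 1 f 0, rotated])
    show "(f has_derivative (\<lambda>h. 0)) (at s within {0..1})" if "s \<in> {0..1} - {0, 1}" for s
    proof (rule has_derivative_at_withinI)
      show "(f has_derivative (\<lambda>h. 0)) (at s)"
        using df[of s] that by (auto simp: has_vector_derivative_def)
    qed
  qed (use that in \<open>auto simp: f_def\<close>)
  \<comment> \<open>\<open>f\<close> is zero, hence so is \<open>g\<close> on (0, 1), and continuity
    at 0 contradicts \<open>g 0 = 1\<close>.\<close>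
  have "eventually (\<lambda>t. g t = 0) (at_right 0)"
    unfolding eventually_at_right_field
  proof (intro exI[of _ 1] conjI allI impI)
    show "g t = 0" if "0 < t" "t < 1" for t
      using f0[of t] that by (simp add: f_def)
  qed simp
  moreover have "(g \<longlongrightarrow> g 0) (at_right 0)"
    using cont(1)[of UNIV] by (simp add: continuous_on_def filterlim_at_split)
  ultimately have "g 0 = 0"
    by (metis tendsto_eventually tendsto_unique trivial_limit_at_right_real)
  then show False
    using g0 by simp
qed

section \<open>Choosing the multiplier \<open>l\<close>\<close>

text \<open>If k x <= 0 for z = x + i y, the term - k x / t of Re q is nonnegative, and only - y^2/4
  can be negative; a multiple of Im q = y (x/2 - k/t) compensates it. For b = 2 a the conclusion is
  absurd, so the lemma then excludes roots off the imaginary axis.\<close>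

lemma kummer_root_sign:
  fixes a b :: real and z :: complex
  assumes b: "b \<ge> 2" and root: "kummer (of_real a) (of_real b) z = 0"
    and nz: "Re z \<noteq> 0 \<or> b \<noteq> 2 * a"
  shows "0 < (b - 2 * a) * Re z"
proof (rule ccontr)
  define k where "k = b / 2 - a"
  define x y where "x = Re z" and "y = Im z"
  assume "\<not> 0 < (b - 2 * a) * Re z"
  then have kx: "k * x \<le> 0"
    by (simp add: k_def x_def algebra_simps)
  have pos0: "0 \<le> b * (b - 2) / (4 * t\<^sup>2)" for t
    using b by simp
  consider "y = 0" | "y \<noteq> 0" "x \<noteq> 0" | "y \<noteq> 0" "x = 0" "k \<noteq> 0"
    using nz by (fastforce simp: x_def k_def)
  then obtain l where l: "\<And>t. 0 < t \<Longrightarrow> t < 1 \<Longrightarrow>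
      0 \<le> (x\<^sup>2 - y\<^sup>2) / 4 - k * x / t + l * y * (x / 2 - k / t)"
  proof cases
    case 1
    have "k * x / t \<le> x\<^sup>2 / 4" if "0 < t" for t
      using divide_nonpos_pos[OF kx that] by (rule order_trans) simp
    then show ?thesis
      using that[of 0] 1 by simp
  next
    case 2
    \<comment> \<open>\<open>N\<close> is chosen so that l y x / 2 = N x^2 / 2 = y^2 / 4 cancels -
      y^2 / 4; what remains of l Im q has the sign of - k x.\<close>
    define N where "N = y\<^sup>2 / (2 * x\<^sup>2)"
    show ?thesis
    proof (rule that[of "N * x / y"])
      fix t :: real assume t: "0 < t" "t < 1"
      have "(x\<^sup>2 - y\<^sup>2) / 4 - k * x / t + N * x / y * y * (x / 2 - k / t)
              = x\<^sup>2 / 4 + (- (k * x) / t) * (1 + N)"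
        using 2 t by (simp add: N_def field_simps power2_eq_square)
      also have "\<dots> \<ge> 0"
        using kx t by (intro add_nonneg_nonneg mult_nonneg_nonneg divide_nonneg_pos) (auto simp: N_def)
      finally show "0 \<le> (x\<^sup>2 - y\<^sup>2) / 4 - k * x / t + N * x / y * y * (x / 2 - k / t)" .
    qed
  next
    case 3
    show ?thesis
    \<comment> \<open>Here Im q = - k y / t, and this \<open>l\<close> turns it into y^2 / (4 t),
      which exceeds y^2 / 4 because t < 1.\<close>
    proof (rule that[of "- y / (4 * k)"])
      fix t :: real assume t: "0 < t" "t < 1"
      have "(x\<^sup>2 - y\<^sup>2) / 4 - k * x / t + - y / (4 * k) * y * (x / 2 - k / t) = y\<^sup>2 / 4 * (1 / t - 1)"
        using 3 t by (simp add: field_simps power2_eq_square)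
      also have "\<dots> \<ge> 0"
        using t by (intro mult_nonneg_nonneg) auto
      finally show "0 \<le> (x\<^sup>2 - y\<^sup>2) / 4 - k * x / t + - y / (4 * k) * y * (x / 2 - k / t)" .
    qed
  qed
  show False
  proof (rule kummer_root_potential[OF b root, of l])
    fix t :: real assume "0 < t" "t < 1"
    from l[OF this] pos0[of t] show "0 \<le> ((Re z)\<^sup>2 - (Im z)\<^sup>2) / 4 - (b / 2 - a) * Re z / t
        + b * (b - 2) / (4 * t\<^sup>2) + l * Im z * (Re z / 2 - (b / 2 - a) / t)"
      by (simp add: x_def y_def k_def)
  qed
qed

text \<open>Now the term B / (4 t^2) with B = b (b - 2) is used as well: Re q + l Im q is a
  quadratic polynomial in 1/t, and the failure of the inequality is what lets some \<open>l\<close>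
  make it nonnegative.\<close>

lemma kummer_root_sector:
  fixes a b :: real and z :: complex
  assumes b: "b \<ge> 2" and root: "kummer (of_real a) (of_real b) z = 0"
    and ab: "b \<noteq> 2 * a"
  shows "b * (b - 2) * (Re z)\<^sup>2 < (b - 2 * a)\<^sup>2 * (norm z)\<^sup>2"
proof (rule ccontr)
  define k where "k = b / 2 - a"
  define x y B where "x = Re z" and "y = Im z" and "B = b * (b - 2)"
  have k: "k \<noteq> 0" and x: "x \<noteq> 0" and B: "B \<ge> 0"
    using ab kummer_root_sign[OF b root] b by (auto simp: k_def x_def B_def)
  have bk: "b - 2 * a = 2 * k"
    by (simp add: k_def)
  assume "\<not> ?thesis"
  then have le: "4 * k\<^sup>2 * (x\<^sup>2 + y\<^sup>2) \<le> B * x\<^sup>2"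
    by (simp add: cmod_power2 bk B_def x_def y_def power_mult_distrib)
  have "\<exists>l. \<forall>t>0. 0 \<le> (x\<^sup>2 - y\<^sup>2) / 4 - k * x / t + B / (4 * t\<^sup>2) + l * y * (x / 2 - k / t)"
  \<comment> \<open>For real z the multiplier has no effect, and B >= 4 k^2 bounds the polynomial
    below by the square of x/2 - k/t.\<close>
  proof (cases "y = 0")
    case True
    have "4 * k\<^sup>2 \<le> B"
      using le x True by simp
    then have "k\<^sup>2 / t\<^sup>2 \<le> B / (4 * t\<^sup>2)" if "t > 0" for t
      using that by (simp add: field_simps)
    moreover have "0 \<le> x\<^sup>2 / 4 - k * x / t + k\<^sup>2 / t\<^sup>2" for t
    proof -
      have "x\<^sup>2 / 4 - k * x / t + k\<^sup>2 / t\<^sup>2 = (x / 2 - k / t)\<^sup>2"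
        by (simp add: power2_diff power_divide mult.commute)
      then show ?thesis
        by simp
    qed
    ultimately have "0 \<le> x\<^sup>2 / 4 - k * x / t + B / (4 * t\<^sup>2)" if "t > 0" for t
      using that add_left_mono order_trans by blast
    then show ?thesis
      using True by auto
  next
    case False
    \<comment> \<open>This \<open>c\<close> makes the terms depending on \<open>t\<close> complete to a square.\<close>
    define c where "c = B * x / (4 * k\<^sup>2)"
    have "0 \<le> (x\<^sup>2 - y\<^sup>2) / 4 - k * x / t + B / (4 * t\<^sup>2) + (c - x) / y * y * (x / 2 - k / t)"
      if t: "t > 0" for t
    proof -
      have "(x\<^sup>2 - y\<^sup>2) / 4 - k * x / t + B / (4 * t\<^sup>2) + (c - x) / y * y * (x / 2 - k / t)
          = B / 4 * (1 / t - x / (2 * k))\<^sup>2 + (B * x\<^sup>2 - 4 * k\<^sup>2 * (x\<^sup>2 + y\<^sup>2)) / (16 * k\<^sup>2)"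
        using t k False by (simp add: c_def field_simps power2_eq_square)
      also have "\<dots> \<ge> 0"
        using B le by (intro add_nonneg_nonneg mult_nonneg_nonneg divide_nonneg_nonneg) auto
      finally show ?thesis .
    qed
    then show ?thesis
      by blast
  qed
  then obtain l where l: "\<And>t. t > 0 \<Longrightarrow>
      0 \<le> (x\<^sup>2 - y\<^sup>2) / 4 - k * x / t + B / (4 * t\<^sup>2) + l * y * (x / 2 - k / t)"
    by blast
  show False
    by (rule kummer_root_potential[OF b root, of l])
      (use l in \<open>auto simp: x_def y_def k_def B_def\<close>)
qed

theorem corollary1:
  fixes a b :: real
  assumes "b \<ge> 2"
  shows "(b = 2 * a \<longrightarrow>
            (\<forall>z. z \<noteq> 0 \<and> kummer (of_real a) (of_real b) z = 0 \<longrightarrow> Re z = 0))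
       \<and> (b > 2 * a \<longrightarrow>
            (\<forall>z. z \<noteq> 0 \<and> kummer (of_real a) (of_real b) z = 0 \<longrightarrow> Re z > 0))
       \<and> (b < 2 * a \<longrightarrow>
            (\<forall>z. z \<noteq> 0 \<and> kummer (of_real a) (of_real b) z = 0 \<longrightarrow> Re z < 0))
       \<and> (b \<noteq> 2 * a \<longrightarrow>
            (\<forall>z. z \<noteq> 0 \<and> kummer (of_real a) (of_real b) z = 0 \<longrightarrow>
              (b - 2 * a)\<^sup>2 * (Im z)\<^sup>2 - (4 * a * (b - a) - 2 * b) * (Re z)\<^sup>2 > 0))"
proof (intro conjI impI allI; elim conjE)
  fix z :: complex
  assume root: "kummer (of_real a) (of_real b) z = 0"
  show "Re z = 0" if "b = 2 * a"
    using kummer_root_sign[OF assms root] that by fastforce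
  show "Re z > 0" if "b > 2 * a"
    using kummer_root_sign[OF assms root] that by (simp add: zero_less_mult_iff)
  show "Re z < 0" if "b < 2 * a"
    using kummer_root_sign[OF assms root] that by (simp add: zero_less_mult_iff)
  \<comment> \<open>With |z|^2 split into squares, the coefficient of (Re z)^2 is (b - 2a)^2 - b(b -
    2) = -(4a(b - a) - 2b).\<close>
  show "(b - 2 * a)\<^sup>2 * (Im z)\<^sup>2 - (4 * a * (b - a) - 2 * b) * (Re z)\<^sup>2 > 0" if "b \<noteq> 2 * a"
    using kummer_root_sector[OF assms root that]
    unfolding cmod_power2 by (simp add: algebra_simps power2_eq_square)
qed

end
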